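(* Let $p>2$ and $a>0$ be real numbers, and let $\Gamma_{p,a}=\{(u,y)=(ay^p,y):y>0\}\subset\mathbb{R}^2$. Then any five distinct points of $\Gamma_{p,a}$ lie on a unique conic, and that conic is a nondegenerate hyperbola. Moreover, writing the conic as $$F+Ey+Cy^2+Du+Buy+Au^2=0$$ in the normalization $A=1$ (which is possible), the coefficient vector $(F,E,C,D,B,A)$ has signs $-,+,-,+,-,+$, that is, $F<0$, $E>0$, $C<0$, $D>0$, $B<0$, $A>0$; in particular $C<0$.
   Context: A conic in the real plane with affine coordinates $(u,y)$ is given by an equation $F+Ey+Cy^2+Du+Buy+Au^2=0$ with real coefficients not all zero, two equations being identified if they are proportional; "unique" means unique up to a nonzero scalar multiple of the equation. The conic is nondegenerate if the associated symmetric $3\times3$ matrix of its homogenization is nonsingular. With discriminant $\Delta=B^2-4AC$, the conic is of hyperbolic type if $\Delta>0$ and of elliptic type if $\Delta<0$; a nondegenerate hyperbola is a nondegenerate conic of hyperbolic type. *)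

theory Defs
  imports "HOL-Analysis.Analysis"
begin

text \<open>The six coefficients of F + E y + C y^2 + D u + B u y + A u^2 = 0, in this order.
  Points of the plane are pairs (u, y).\<close>

datatype conic_eqn =
  Conic_Eqn (coefF: real) (coefE: real) (coefC: real) (coefD: real) (coefB: real) (coefA: real)

definition is_conic :: "conic_eqn \<Rightarrow> bool" where
  "is_conic k \<longleftrightarrow> k \<noteq> Conic_Eqn 0 0 0 0 0 0"

definition conic_locus :: "conic_eqn \<Rightarrow> (real \<times> real) set" where
  "conic_locus k = {(u, y). coefF k + coefE k * y + coefC k * y\<^sup>2
      + coefD k * u + coefB k * u * y + coefA k * u\<^sup>2 = 0}"

definition scale_eqn :: "real \<Rightarrow> conic_eqn \<Rightarrow> conic_eqn" where
  "scale_eqn c k = Conic_Eqn (c * coefF k) (c * coefE k) (c * coefC k)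
      (c * coefD k) (c * coefB k) (c * coefA k)"

text \<open>Two equations define the same conic iff they are related by this equivalence.\<close>

definition proportional :: "conic_eqn \<Rightarrow> conic_eqn \<Rightarrow> bool" where
  "proportional k k' \<longleftrightarrow> (\<exists>c. c \<noteq> 0 \<and> k' = scale_eqn c k)"

definition conic_matrix :: "conic_eqn \<Rightarrow> real^3^3" where
  "conic_matrix k = vector
     [vector [coefA k, coefB k / 2, coefD k / 2],
      vector [coefB k / 2, coefC k, coefE k / 2],
      vector [coefD k / 2, coefE k / 2, coefF k]]"

text \<open>The homogeneous coordinates are ordered as (u, y, w), with w homogenizing.\<close>

lemma conic_matrix_quadratic_form:
  "(vector [u, y, w] :: real^3) \<bullet> (conic_matrix k *v vector [u, y, w]) =
     coefF k * w\<^sup>2 + coefE k * y * w + coefC k * y\<^sup>2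
     + coefD k * u * w + coefB k * u * y + coefA k * u\<^sup>2"
  by (simp add: conic_matrix_def inner_vec_def matrix_vector_mult_def sum_3
      power2_eq_square algebra_simps)

lemma transpose_conic_matrix: "transpose (conic_matrix k) = conic_matrix k"
  by (simp add: conic_matrix_def transpose_def vec_eq_iff forall_3)

definition nondegenerate :: "conic_eqn \<Rightarrow> bool" where
  "nondegenerate k \<longleftrightarrow> invertible (conic_matrix k)"

definition discriminant :: "conic_eqn \<Rightarrow> real" where
  "discriminant k = (coefB k)\<^sup>2 - 4 * coefA k * coefC k"

definition hyperbolic_type :: "conic_eqn \<Rightarrow> bool" where
  "hyperbolic_type k \<longleftrightarrow> discriminant k > 0"

definition nondegenerate_hyperbola :: "conic_eqn \<Rightarrow> bool" where
  "nondegenerate_hyperbola k \<longleftrightarrow> is_conic k \<and> nondegenerate k \<and> hyperbolic_type k"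

definition power_curve :: "real \<Rightarrow> real \<Rightarrow> (real \<times> real) set" where
  "power_curve p a = {(a * y powr p, y) |y. y > 0}"

end

theory Submission
  imports Defs
begin

text \<open>Restricted to the curve, the equation of a conic becomes a linear combination of
  \<open>y\<close> to the powers \<open>0 < 1 < 2 < p < p + 1 < 2 p\<close>. By Rolle's theorem (the induction behind
  Descartes' rule of signs), a nonzero combination of \<open>m + 1\<close> real powers with \<open>m\<close> positive zeros
  has coefficients of strictly alternating signs. This gives the signs, and uniqueness because a
  combination of two conics can be made to have \<open>A = 0\<close>. Since \<open>A\<close> and \<open>C\<close> have opposite signs,
  the conic is hyperbolic; if it were degenerate, it would be a pair of real lines, each of which
  meets the convex curve in at most two points.\<close>

section \<open>Zeros of sums of real powers\<close>

text \<open>Induction that splits off the largest zero. Bounding \<open>W\<close> by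
  \<open>Max Z\<close> in the claim guarantees that the zero of \<open>f'\<close> found beyond the
  remaining zeros of \<open>f\<close> is new.\<close>

lemma Rolle_finite_zeros:
  fixes f f' :: "real \<Rightarrow> real"
  assumes "finite Z" "Z \<subseteq> {a<..}" "card Z = Suc m"
    and der: "\<And>y. y > a \<Longrightarrow> (f has_real_derivative f' y) (at y)"
    and "\<And>y. y \<in> Z \<Longrightarrow> f y = 0"
  obtains W where "finite W" "W \<subseteq> {a<..<Max Z}" "card W = m" "\<And>y. y \<in> W \<Longrightarrow> f' y = 0"
proof -
  have "\<exists>W. finite W \<and> W \<subseteq> {a<..<Max Z} \<and> card W = m \<and> (\<forall>y\<in>W. f' y = 0)"
    using assms(1-3,5)
  proof (induction m arbitrary: Z)
    case 0
    then show ?case by (intro exI[of _ "{}"]) auto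
  next
    case (Suc m)
    define M where "M = Max Z"
    define Y where "Y = Z - {M}"
    have "Z \<noteq> {}" using Suc.prems by auto
    then have M: "M \<in> Z" using Suc.prems M_def by auto
    have Y: "finite Y" "Y \<subseteq> {a<..}" "card Y = Suc m" "\<And>y. y \<in> Y \<Longrightarrow> f y = 0"
      using Suc.prems M unfolding Y_def by auto
    from Suc.IH[OF Y] obtain W where
      W: "finite W" "W \<subseteq> {a<..<Max Y}" "card W = m" "\<forall>y\<in>W. f' y = 0" by blast
    have "Y \<noteq> {}" using Y by auto
    then have MY: "Max Y \<in> Y" using Y by simp
    then have less: "Max Y < M"
      using Suc.prems(1) Max_ge[of Z "Max Y"] unfolding Y_def M_def
      by (metis DiffE insertI1 order_le_imp_less_or_eq)
    have "a < Max Y" using MY Y by auto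
    have "\<exists>w>Max Y. w < M \<and> f' w = 0"
    proof -
      have "continuous_on {Max Y..M} f"
        using \<open>a < Max Y\<close>
        by (intro DERIV_continuous_on[of _ _ f'] has_field_derivative_at_within[OF der]) auto
      moreover have "\<And>x. Max Y < x \<Longrightarrow> x < M \<Longrightarrow> (f has_derivative (*) (f' x)) (at x)"
        using der \<open>a < Max Y\<close> by (simp add: has_field_derivative_def)
      moreover have "f (Max Y) = f M" using Suc.prems(4) MY M by (simp add: Y_def)
      ultimately obtain w where w: "Max Y < w" "w < M" "(*) (f' w) = (\<lambda>v. 0)"
        using Rolle_deriv[OF less, of f "\<lambda>x. (*) (f' x)"] by blast
      \<comment> \<open>The derivative is given as a linear map here; evaluating it at 1 yields
        \<open>f' w = 0\<close>.\<close>
      from fun_cong[OF w(3), of 1] w(1,2) show ?thesis by (intro exI[of _ w]) simp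
    qed
    then obtain w where w: "w > Max Y" "w < M" "f' w = 0" by blast
    have "w \<notin> W" using W w by auto
    then show ?case
      using W w less \<open>a < Max Y\<close> by (intro exI[of _ "insert w W"]) (force simp: M_def)
  qed
  then show ?thesis using that by blast
qed

text \<open>Multiplying the sum by \<open>y powr (- s)\<close> keeps its positive zeros, so Rolle's
  theorem applies to the shifted powers. Taking one of the exponents as \<open>s\<close> makes that
  term vanish on differentiation.\<close>

lemma deriv_sum_powr_zeros:
  fixes c e :: "nat \<Rightarrow> real"
  assumes "finite I" "finite Z" "Z \<subseteq> {0<..}" "card Z = Suc m"
    and "\<And>y. y \<in> Z \<Longrightarrow> (\<Sum>i\<in>I. c i * y powr e i) = 0"
  obtains W where "finite W" "W \<subseteq> {0<..}" "card W = m"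
    "\<And>y. y \<in> W \<Longrightarrow> (\<Sum>i\<in>I. c i * (e i - s) * y powr (e i - s - 1)) = 0"
proof -
  let ?f = "\<lambda>y. \<Sum>i\<in>I. c i * y powr (e i - s)"
  have "(?f has_real_derivative (\<Sum>i\<in>I. c i * (e i - s) * y powr (e i - s - 1))) (at y)"
    if "y > 0" for y
    using that by (auto intro!: derivative_eq_intros sum.cong simp: algebra_simps)
  moreover have "?f y = 0" if "y \<in> Z" for y
  proof -
    have "?f y = y powr (- s) * (\<Sum>i\<in>I. c i * y powr e i)"
      by (auto simp: sum_distrib_left powr_diff powr_minus field_simps intro!: sum.cong)
    then show ?thesis using assms(5)[OF that] by simp
  qed
  ultimately obtain W where "finite W" "W \<subseteq> {0<..<Max Z}" "card W = m"
    "\<And>y. y \<in> W \<Longrightarrow> (\<Sum>i\<in>I. c i * (e i - s) * y powr (e i - s - 1)) = 0"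
    using Rolle_finite_zeros[OF assms(2-4), of ?f
        "\<lambda>y. \<Sum>i\<in>I. c i * (e i - s) * y powr (e i - s - 1)"] by blast
  moreover from this have "W \<subseteq> {0<..}" by auto
  ultimately show ?thesis using that by blast
qed

text \<open>The extremal case of Descartes' bound: unless all coefficients vanish, \<open>m\<close>
  zeros for \<open>m + 1\<close> terms determine the signs up to a global sign. In the induction,
  removing the first and the last term in turn gives alternation on two blocks that together cover
  all coefficients.\<close>

theorem sum_powr_zeros_alternating:
  fixes c e :: "nat \<Rightarrow> real"
  assumes "strict_mono_on {..m} e" "finite Z" "Z \<subseteq> {0<..}" "card Z = m"
    and "\<And>y. y \<in> Z \<Longrightarrow> (\<Sum>i\<le>m. c i * y powr e i) = 0"
  shows "(\<forall>i\<le>m. c i = 0) \<or> (\<forall>i<m. c i * c (Suc i) < 0)"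
  using assms
proof (induction m arbitrary: c e Z)
  case 0
  then show ?case by simp
next
  case (Suc m)
  have mono: "e i < e j" if "i < j" "j \<le> Suc m" for i j
    using Suc.prems(1) that by (auto simp: strict_mono_on_def)
  have "Z \<noteq> {}" using Suc.prems by auto
  then obtain z where z: "z \<in> Z" "z > 0" using Suc.prems by auto
  have zsum: "(\<Sum>i\<le>Suc m. c i * z powr e i) = 0" using Suc.prems z by blast
  txt \<open>Dividing by the lowest power before differentiating removes its term;
    dividing by the highest removes the last one.\<close>
  have low: "(\<forall>i\<le>m. c (Suc i) = 0) \<or> (\<forall>i<m. c (Suc i) * c (Suc (Suc i)) < 0)"
  proof -
    let ?c = "\<lambda>i. c (Suc i) * (e (Suc i) - e 0)"
    obtain W where W: "finite W" "W \<subseteq> {0<..}" "card W = m" and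
      "\<And>y. y \<in> W \<Longrightarrow> (\<Sum>i\<le>Suc m. c i * (e i - e 0) * y powr (e i - e 0 - 1)) = 0"
      using deriv_sum_powr_zeros[OF _ Suc.prems(2-5)] by blast
    then have "\<And>y. y \<in> W \<Longrightarrow> (\<Sum>i\<le>m. ?c i * y powr (e (Suc i) - e 0 - 1)) = 0"
      by (simp add: sum.atMost_Suc_shift del: sum.atMost_Suc)
    moreover have "strict_mono_on {..m} (\<lambda>i. e (Suc i) - e 0 - 1)"
      by (auto simp: strict_mono_on_def mono)
    ultimately have *: "(\<forall>i\<le>m. ?c i = 0) \<or> (\<forall>i<m. ?c i * ?c (Suc i) < 0)"
      using Suc.IH[of "\<lambda>i. e (Suc i) - e 0 - 1" W ?c] W by blast
    \<comment> \<open>Every factor introduced by differentiation is positive, so \<open>?c\<close>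
      has the sign pattern of \<open>c\<close> shifted by one.\<close>
    have pos: "e (Suc i) - e 0 > 0" if "i \<le> m" for i using mono[of 0 "Suc i"] that by simp
    have "c (Suc i) = 0 \<longleftrightarrow> ?c i = 0" if "i \<le> m" for i using pos[OF that] by simp
    moreover have "c (Suc i) * c (Suc (Suc i)) < 0 \<longleftrightarrow> ?c i * ?c (Suc i) < 0" if "i < m" for i
      using pos[of i] pos[of "Suc i"] that by (auto simp: mult_less_0_iff zero_less_mult_iff)
    ultimately show ?thesis using * by auto
  qed
  have high: "(\<forall>i\<le>m. c i = 0) \<or> (\<forall>i<m. c i * c (Suc i) < 0)"
  proof -
    let ?c = "\<lambda>i. c i * (e i - e (Suc m))"
    obtain W where W: "finite W" "W \<subseteq> {0<..}" "card W = m" and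
      "\<And>y. y \<in> W \<Longrightarrow>
        (\<Sum>i\<le>Suc m. c i * (e i - e (Suc m)) * y powr (e i - e (Suc m) - 1)) = 0"
      using deriv_sum_powr_zeros[OF _ Suc.prems(2-5)] by blast
    then have "\<And>y. y \<in> W \<Longrightarrow> (\<Sum>i\<le>m. ?c i * y powr (e i - e (Suc m) - 1)) = 0"
      by simp
    moreover have "strict_mono_on {..m} (\<lambda>i. e i - e (Suc m) - 1)"
      by (auto simp: strict_mono_on_def mono)
    ultimately have *: "(\<forall>i\<le>m. ?c i = 0) \<or> (\<forall>i<m. ?c i * ?c (Suc i) < 0)"
      using Suc.IH[of "\<lambda>i. e i - e (Suc m) - 1" W ?c] W by blast
    \<comment> \<open>Here all factors are negative, which leaves the signs of products of
      neighbours unchanged.\<close>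
    have neg: "e i - e (Suc m) < 0" if "i \<le> m" for i using mono[of i "Suc m"] that by simp
    have "c i = 0 \<longleftrightarrow> ?c i = 0" if "i \<le> m" for i using neg[OF that] by simp
    moreover have "c i * c (Suc i) < 0 \<longleftrightarrow> ?c i * ?c (Suc i) < 0" if "i < m" for i
      using neg[of i] neg[of "Suc i"] that by (auto simp: mult_less_0_iff zero_less_mult_iff)
    ultimately show ?thesis using * by auto
  qed
  show ?case
  \<comment> \<open>If one block vanishes, a single term is left, and its value 0 at
    \<open>z\<close> forces its coefficient to be 0.\<close>
  proof (cases "(\<forall>i\<le>m. c (Suc i) = 0) \<or> (\<forall>i\<le>m. c i = 0)")
    case True
    then have "\<forall>i\<le>Suc m. c i = 0"
    proof
      assume zero: "\<forall>i\<le>m. c (Suc i) = 0"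
      then have "c 0 = 0"
        using zsum z by (simp add: sum.atMost_Suc_shift del: sum.atMost_Suc)
      with zero show ?thesis by (metis Suc_le_mono not0_implies_Suc)
    next
      assume "\<forall>i\<le>m. c i = 0"
      with zsum z show ?thesis by (auto simp: le_Suc_eq)
    qed
    then show ?thesis ..
  next
    case False
    with low high have lo: "\<And>i. i < m \<Longrightarrow> c (Suc i) * c (Suc (Suc i)) < 0"
      and hi: "\<And>i. i < m \<Longrightarrow> c i * c (Suc i) < 0" by blast+
    \<comment> \<open>For \<open>m > 0\<close> this is alternation in the block without the last
      term. For \<open>m = 0\<close> both blocks are single coefficients and give no relative sign,
      so the two-term equation at \<open>z\<close> has to supply it.\<close>
    have "c 0 * c (Suc 0) < 0"
    proof (cases m)
      case 0
      have "c 0 * z powr e 0 = - (c 1 * z powr e 1)" using zsum 0 by simp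
      moreover have "z powr e 0 > 0" "z powr e 1 > 0" using z by auto
      moreover have "c 0 \<noteq> 0" "c 1 \<noteq> 0" using False 0 by auto
      ultimately show ?thesis
        by (smt (verit) mult_neg_neg mult_pos_pos mult_neg_pos mult_pos_neg One_nat_def)
    qed (use hi in simp)
    then show ?thesis
      using lo by (metis Suc_less_eq not0_implies_Suc)
  qed
qed

section \<open>Homogeneous linear systems\<close>

text \<open>Gaussian elimination, one equation \<open>z\<close> at a time: an equation whose
  coefficients \<open>g i z\<close> are all zero is dropped; otherwise a pivot \<open>j\<close>
  eliminates one unknown.\<close>

lemma homogeneous_system_nontrivial_solution:
  fixes g :: "'i \<Rightarrow> 'z \<Rightarrow> 'a :: field"
  assumes "finite Z" "finite I" "card Z < card I"
  shows "\<exists>c. (\<exists>i\<in>I. c i \<noteq> 0) \<and> (\<forall>z\<in>Z. (\<Sum>i\<in>I. c i * g i z) = 0)"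
  using assms
proof (induction Z arbitrary: I g rule: finite_induct)
  case empty
  then have "I \<noteq> {}" by auto
  then show ?case by (intro exI[of _ "\<lambda>_. 1"]) auto
next
  case (insert z Z)
  show ?case
  proof (cases "\<forall>i\<in>I. g i z = 0")
    case True
    have "card Z < card I" using insert by simp
    from insert.IH[OF insert.prems(1) this, of g] show ?thesis using True by auto
  next
    case False
    then obtain j where j: "j \<in> I" "g j z \<noteq> 0" by blast
    define J where "J = I - {j}"
    have J: "finite J" "card Z < card J" "j \<notin> J" "I = insert j J"
      using insert j by (auto simp: J_def)
    from insert.IH[OF J(1,2), of "\<lambda>i w. g i w - g i z / g j z * g j w"]
    obtain c where c: "\<exists>i\<in>J. c i \<noteq> 0"
      "\<And>w. w \<in> Z \<Longrightarrow> (\<Sum>i\<in>J. c i * (g i w - g i z / g j z * g j w)) = 0" by blast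
    \<comment> \<open>Back substitution: the eliminated unknown takes the value \<open>- q\<close>,
      the one that solves equation \<open>z\<close>.\<close>
    define q where "q = (\<Sum>i\<in>J. c i * g i z) / g j z"
    define d where "d = c(j := - q)"
    have d: "(\<Sum>i\<in>I. d i * g i w) = (\<Sum>i\<in>J. c i * g i w) - q * g j w" for w
    proof -
      have "(\<Sum>i\<in>J. d i * g i w) = (\<Sum>i\<in>J. c i * g i w)"
        using J(3) by (intro sum.cong) (auto simp: d_def)
      then show ?thesis using J by (simp add: d_def)
    qed
    have "(\<Sum>i\<in>I. d i * g i z) = 0" using j by (simp add: d q_def)
    moreover have "(\<Sum>i\<in>I. d i * g i w) = 0" if "w \<in> Z" for w
    proof -
      have "(\<Sum>i\<in>J. c i * (g i w - g i z / g j z * g j w)) = (\<Sum>i\<in>J. c i * g i w) - q * g j w"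
        by (simp add: q_def right_diff_distrib sum_subtractf sum_distrib_right
            sum_divide_distrib mult.assoc)
      then show ?thesis using c(2)[OF that] d by simp
    qed
    moreover have "\<exists>i\<in>I. d i \<noteq> 0" using c(1) J by (auto simp: d_def)
    ultimately show ?thesis by blast
  qed
qed

section \<open>Lines and conics restricted to the curve\<close>

lemma inj_on_snd_power_curve: "inj_on snd (power_curve p a)"
  by (auto simp: inj_on_def power_curve_def)

lemma mem_subset_power_curve:
  assumes "S \<subseteq> power_curve p a" "y \<in> snd ` S"
  shows "y > 0" "(a * y powr p, y) \<in> S"
proof -
  obtain u where u: "(u, y) \<in> S" using assms(2) by auto
  with assms(1) have "(u, y) \<in> power_curve p a" by blast
  then show "y > 0" "(a * y powr p, y) \<in> S" using u by (auto simp: power_curve_def)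
qed

text \<open>The equation is that of the line \<open>u + b * y + d = 0\<close> at
  \<open>u = a * y powr p\<close>, so this bounds the number of points that such a line shares with
  the curve.\<close>

lemma card_line_power_curve_le:
  fixes p a b d :: real
  assumes "p > 1" "a \<noteq> 0" "finite Z" "Z \<subseteq> {0<..}"
    and "\<And>y. y \<in> Z \<Longrightarrow> a * y powr p + b * y + d = 0"
  shows "card Z \<le> 2"
proof (rule ccontr)
  assume "\<not> card Z \<le> 2"
  then have "3 \<le> card Z" by simp
  then obtain Y where Y: "Y \<subseteq> Z" "card Y = 3" "finite Y"
    by (rule obtain_subset_with_card_n)
  let ?e = "\<lambda>i. [0, 1, p, p + 1] ! i :: real" and ?c = "\<lambda>i. [d, b, a, 0] ! i :: real"
  txt \<open>The artificial fourth term with coefficient 0 rules out alternating signs.\<close>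
  have "(\<forall>i\<le>3. ?c i = 0) \<or> (\<forall>i<3. ?c i * ?c (Suc i) < 0)"
  proof (rule sum_powr_zeros_alternating[of 3 ?e Y])
    show "strict_mono_on {..3} ?e"
      using assms(1) by (auto simp: strict_mono_on_def numeral_eq_Suc le_Suc_eq less_Suc_eq)
    show "(\<Sum>i\<le>3. ?c i * y powr ?e i) = 0" if "y \<in> Y" for y
    proof -
      have "y > 0" "a * y powr p + b * y + d = 0" using assms(4,5) Y(1) that by auto
      then show ?thesis by (simp add: numeral_eq_Suc algebra_simps)
    qed
  qed (use Y assms in auto)
  then have "?c 2 = 0 \<or> ?c 2 * ?c (Suc 2) < 0"
    by (elim disjE allE[of _ 2]) simp_all
  then show False using assms(2) by simp
qed

text \<open>Substituting \<open>u = a * y powr p\<close> gives six powers of \<open>y\<close>, and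
  \<open>p > 2\<close> puts their exponents in the order F, E, C, D, B, A. The positive factors
  \<open>a\<close> and \<open>a\<^sup>2\<close> do not affect signs. Products of neighbours are used
  because they survive rescaling of the equation.\<close>

lemma conic_power_curve_signs:
  assumes "p > 2" "a > 0" "S \<subseteq> power_curve p a" "card S = 5" "S \<subseteq> conic_locus k" "is_conic k"
  shows "coefF k * coefE k < 0 \<and> coefE k * coefC k < 0 \<and> coefC k * coefD k < 0 \<and>
    coefD k * coefB k < 0 \<and> coefB k * coefA k < 0"
proof -
  let ?e = "\<lambda>i. [0, 1, 2, p, p + 1, 2 * p] ! i"
  let ?c = "\<lambda>i. [coefF k, coefE k, coefC k, a * coefD k, a * coefB k, a\<^sup>2 * coefA k] ! i"
  \<comment> \<open>Distinct points of the curve have distinct ordinates, so five points give five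
    zeros for the six terms.\<close>
  have "inj_on snd S"
    using inj_on_snd_power_curve assms(3) by (rule inj_on_subset)
  then have card: "card (snd ` S) = 5" using assms(4) card_image by metis
  have "(\<forall>i\<le>5. ?c i = 0) \<or> (\<forall>i<5. ?c i * ?c (Suc i) < 0)"
  proof (rule sum_powr_zeros_alternating[of 5 ?e "snd ` S"])
    show "strict_mono_on {..5} ?e"
      using assms(1) by (auto simp: strict_mono_on_def numeral_eq_Suc le_Suc_eq less_Suc_eq)
    show "finite (snd ` S)" using card by (simp add: card_ge_0_finite)
    show "snd ` S \<subseteq> {0<..}" using mem_subset_power_curve(1)[OF assms(3)] by blast
    fix y assume "y \<in> snd ` S"
    note y = mem_subset_power_curve[OF assms(3) this]
    have "y powr 2 = y\<^sup>2" "y powr (2 * p) = (y powr p)\<^sup>2" "y powr (p + 1) = y powr p * y"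
      using y(1) powr_add[of y p p] powr_add[of y p 1] by (simp_all add: power2_eq_square)
    moreover have "coefF k + coefE k * y + coefC k * y\<^sup>2 + coefD k * (a * y powr p)
      + coefB k * (a * y powr p) * y + coefA k * (a * y powr p)\<^sup>2 = 0"
      using y(2) assms(5) by (auto simp: conic_locus_def)
    ultimately show "(\<Sum>i\<le>5. ?c i * y powr ?e i) = 0"
      using y(1) by (simp add: eval_nat_numeral algebra_simps)
  qed (use card in simp)
  then show ?thesis
  proof
    assume zero: "\<forall>i\<le>5. ?c i = 0"
    have "?c 0 = 0" "?c 1 = 0" "?c 2 = 0" "?c 3 = 0" "?c 4 = 0" "?c 5 = 0"
      by (rule zero[rule_format], simp)+
    then have "k = Conic_Eqn 0 0 0 0 0 0"
      using assms(2) by (cases k) simp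
    with assms(6) show ?thesis by (simp add: is_conic_def)
  next
    assume alt: "\<forall>i<5. ?c i * ?c (Suc i) < 0"
    have "?c 0 * ?c (Suc 0) < 0" "?c 1 * ?c (Suc 1) < 0" "?c 2 * ?c (Suc 2) < 0"
      "?c 3 * ?c (Suc 3) < 0" "?c 4 * ?c (Suc 4) < 0"
      by (rule alt[rule_format], simp)+
    then show ?thesis
      using assms(2) by (auto simp: mult_less_0_iff zero_less_mult_iff)
  qed
qed

section \<open>Existence and uniqueness of the conic\<close>

text \<open>Each point imposes one linear condition on the six coefficients, so five points of the
  plane leave a nonzero solution.\<close>

lemma ex_conic_through_five_points:
  assumes "card S = 5"
  shows "\<exists>k. is_conic k \<and> S \<subseteq> conic_locus k"
proof -
  let ?g = "\<lambda>i (u, y). [1, y, y\<^sup>2, u, u * y, u\<^sup>2] ! i :: real"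
  have "finite S" using assms by (simp add: card_ge_0_finite)
  have "card S < card {..<6::nat}" using assms by simp
  from homogeneous_system_nontrivial_solution[OF \<open>finite S\<close> finite_lessThan this, of ?g]
  obtain c where c: "\<exists>i\<in>{..<6}. c i \<noteq> 0"
    "\<forall>z\<in>S. (\<Sum>i\<in>{..<6::nat}. c i * ?g i z) = 0" by blast
  let ?k = "Conic_Eqn (c 0) (c 1) (c 2) (c 3) (c 4) (c 5)"
  have "is_conic ?k"
    using c(1) by (auto simp: is_conic_def eval_nat_numeral less_Suc_eq)
  moreover have "S \<subseteq> conic_locus ?k"
    using c(2) by (fastforce simp: conic_locus_def eval_nat_numeral algebra_simps)
  ultimately show ?thesis by blast
qed

lemma proportional_conic_power_curve:
  assumes "p > 2" "a > 0" "S \<subseteq> power_curve p a" "card S = 5"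
    and k: "S \<subseteq> conic_locus k" "is_conic k" and k': "S \<subseteq> conic_locus k'" "is_conic k'"
  shows "proportional k k'"
proof -
  have A: "coefA k \<noteq> 0" "coefA k' \<noteq> 0"
    using conic_power_curve_signs[OF assms(1-4)] k k' by fastforce+
  \<comment> \<open>With this factor the combination \<open>k' - t k\<close> has no
    \<open>u\<^sup>2\<close> term.\<close>
  define t where "t = coefA k' / coefA k"
  let ?d = "Conic_Eqn (coefF k' - t * coefF k) (coefE k' - t * coefE k) (coefC k' - t * coefC k)
    (coefD k' - t * coefD k) (coefB k' - t * coefB k) 0"
  have tA: "coefA k' = t * coefA k" using A by (simp add: t_def)
  have "S \<subseteq> conic_locus ?d"
  proof (clarsimp simp: conic_locus_def)
    fix u y assume "(u, y) \<in> S"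
    then have "coefF k + coefE k * y + coefC k * y\<^sup>2 + coefD k * u + coefB k * u * y
        + coefA k * u\<^sup>2 = 0" (is "?l = 0")
      and "coefF k' + coefE k' * y + coefC k' * y\<^sup>2 + coefD k' * u + coefB k' * u * y
        + t * coefA k * u\<^sup>2 = 0" (is "?l' = 0")
      using k k' by (auto simp: conic_locus_def simp flip: tA)
    then have "?l' - t * ?l = 0" by simp
    then show "coefF k' - t * coefF k + (coefE k' - t * coefE k) * y
       + (coefC k' - t * coefC k) * y\<^sup>2 + (coefD k' - t * coefD k) * u
       + (coefB k' - t * coefB k) * u * y = 0"
      by (simp add: algebra_simps)
  qed
  \<comment> \<open>For a conic through \<open>S\<close> the product of B and A is negative, which
    is impossible when A is 0.\<close>
  then have "\<not> is_conic ?d"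
    using conic_power_curve_signs[OF assms(1-4), of ?d] by auto
  then have "k' = scale_eqn t k"
    using tA by (cases k') (simp add: is_conic_def scale_eqn_def)
  moreover have "t \<noteq> 0" using A by (simp add: t_def)
  ultimately show ?thesis by (auto simp: proportional_def)
qed

section \<open>Nondegeneracy\<close>

text \<open>The positive discriminant has a real square root, so the degenerate equation splits over
  the reals. As A is nonzero, both factors can be scaled to have \<open>u\<close>-coefficient 1, the
  form needed for counting points on a line.\<close>

lemma degenerate_hyperbolic_two_lines:
  assumes "\<not> nondegenerate k" "hyperbolic_type k" "coefA k \<noteq> 0"
  obtains b d b' d' where
    "\<And>u y. (u, y) \<in> conic_locus k \<longleftrightarrow> u + b * y + d = 0 \<or> u + b' * y + d' = 0"
proof -
  define A B C D E F where defs: "A = coefA k" "B = coefB k" "C = coefC k" "D = coefD k"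
    "E = coefE k" "F = coefF k"
  have A: "A \<noteq> 0" using assms by (simp add: defs)
  define n where "n = B\<^sup>2 - 4 * A * C"
  have n: "n > 0" using assms(2) by (simp add: n_def hyperbolic_type_def discriminant_def defs)
  define r where "r = sqrt n"
  have r: "r > 0" "r\<^sup>2 = n" using n by (simp_all add: r_def)
  have "det (conic_matrix k) = 0"
    using assms(1) by (simp add: nondegenerate_def invertible_det_nz)
  \<comment> \<open>The left-hand side is four times the determinant.\<close>
  then have det0: "4 * A * C * F + B * D * E - F * B\<^sup>2 - C * D\<^sup>2 - A * E\<^sup>2 = 0"
    by (simp add: conic_matrix_def det_3 power2_eq_square algebra_simps flip: defs)
  have det: "(B * D - 2 * A * E)\<^sup>2 = n * (D\<^sup>2 - 4 * A * F)"
  proof -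
    have "(B * D - 2 * A * E)\<^sup>2 - n * (D\<^sup>2 - 4 * A * F) =
        - 4 * A * (4 * A * C * F + B * D * E - F * B\<^sup>2 - C * D\<^sup>2 - A * E\<^sup>2)"
      by (simp add: n_def power2_eq_square algebra_simps)
    with det0 show ?thesis by simp
  qed
  txt \<open>Complete the square in \<open>u\<close>; the remaining quadratic in \<open>y\<close> has discriminant zero.\<close>
  define s where "s = (B * D - 2 * A * E) / r"
  have s: "s * r = B * D - 2 * A * E" using r by (simp add: s_def)
  have s2: "s\<^sup>2 = D\<^sup>2 - 4 * A * F"
    using det n r by (simp add: s_def power_divide)
  \<comment> \<open>Difference of the squares of \<open>2 * A * u + B * y + D\<close> and
    \<open>r * y + s\<close>.\<close>
  have "4 * A * (F + E * y + C * y\<^sup>2 + D * u + B * u * y + A * u\<^sup>2) =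
      (2 * A * u + (B + r) * y + (D + s)) * (2 * A * u + (B - r) * y + (D - s))" for u y
  proof -
    have "(2 * A * u + (B + r) * y + (D + s)) * (2 * A * u + (B - r) * y + (D - s)) =
        (2 * A * u + B * y + D)\<^sup>2 - (r\<^sup>2 * y\<^sup>2 + 2 * (s * r) * y + s\<^sup>2)"
      by (simp add: power2_eq_square algebra_simps)
    then show ?thesis
      unfolding s s2 r(2) n_def by (simp add: power2_eq_square algebra_simps)
  qed
  then have "F + E * y + C * y\<^sup>2 + D * u + B * u * y + A * u\<^sup>2 = 0 \<longleftrightarrow>
      2 * A * u + (B + r) * y + (D + s) = 0 \<or> 2 * A * u + (B - r) * y + (D - s) = 0" for u y
    using A by (metis mult_eq_0_iff zero_neq_numeral)
  moreover have "2 * A * u + v * y + w = 0 \<longleftrightarrow> u + v / (2 * A) * y + w / (2 * A) = 0" for u v y w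
    using A by (simp add: field_simps)
  ultimately have "(u, y) \<in> conic_locus k \<longleftrightarrow>
      u + (B + r) / (2 * A) * y + (D + s) / (2 * A) = 0 \<or>
      u + (B - r) / (2 * A) * y + (D - s) / (2 * A) = 0" for u y
    by (simp add: conic_locus_def flip: defs)
  then show ?thesis using that by blast
qed

text \<open>Pigeonhole on ordinates: two lines account for at most four of the five points.\<close>

lemma nondegenerate_conic_power_curve:
  assumes "p > 1" "a > 0" "S \<subseteq> power_curve p a" "card S = 5"
    and "S \<subseteq> conic_locus k" "hyperbolic_type k" "coefA k \<noteq> 0"
  shows "nondegenerate k"
proof (rule ccontr)
  assume "\<not> nondegenerate k"
  then obtain b d b' d' where lines:
    "\<And>u y. (u, y) \<in> conic_locus k \<longleftrightarrow> u + b * y + d = 0 \<or> u + b' * y + d' = 0"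
    using degenerate_hyperbolic_two_lines assms(6,7) by blast
  let ?Z = "snd ` S"
  let ?Y = "\<lambda>b d. {y \<in> ?Z. a * y powr p + b * y + d = 0}"
  have fin: "finite ?Z" using assms(4) by (simp add: card_ge_0_finite)
  have pos: "?Z \<subseteq> {0<..}" using mem_subset_power_curve(1)[OF assms(3)] by blast
  have le2: "card (?Y b d) \<le> 2" for b d
  proof (rule card_line_power_curve_le)
    show "finite (?Y b d)" using fin by simp
    show "?Y b d \<subseteq> {0<..}" using pos by blast
    show "a * y powr p + b * y + d = 0" if "y \<in> ?Y b d" for y using that by simp
  qed (use assms(1,2) in auto)
  have "card (?Y b d) + card (?Y b' d') \<le> 4" using le2[of b d] le2[of b' d'] by linarith
  moreover have "?Z \<subseteq> ?Y b d \<union> ?Y b' d'"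
  proof
    fix y assume y: "y \<in> ?Z"
    then have "(a * y powr p, y) \<in> S" using mem_subset_power_curve(2)[OF assms(3)] by blast
    then have "(a * y powr p, y) \<in> conic_locus k" using assms(5) by blast
    then show "y \<in> ?Y b d \<union> ?Y b' d'" using y lines by auto
  qed
  then have "card ?Z \<le> card (?Y b d) + card (?Y b' d')"
    using fin card_mono[of "?Y b d \<union> ?Y b' d'" ?Z] card_Un_le[of "?Y b d" "?Y b' d'"]
    by (simp del: Un_subset_iff)
  moreover have "inj_on snd S"
    using inj_on_snd_power_curve assms(3) by (rule inj_on_subset)
  then have "card ?Z = 5" using assms(4) card_image by metis
  ultimately show False by simp
qed

theorem proposition5:
  fixes p a :: real and S :: "(real \<times> real) set"
  assumes "p > 2" and "a > 0"
    and "S \<subseteq> power_curve p a" and "card S = 5"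
  shows "(\<exists>k. is_conic k \<and> S \<subseteq> conic_locus k \<and>
            (\<forall>k'. is_conic k' \<and> S \<subseteq> conic_locus k' \<longrightarrow> proportional k k')) \<and>
         (\<forall>k. is_conic k \<and> S \<subseteq> conic_locus k \<longrightarrow>
            nondegenerate_hyperbola k \<and>
            (\<exists>k'. proportional k k' \<and> coefA k' = 1) \<and>
            (\<forall>k'. proportional k k' \<and> coefA k' = 1 \<longrightarrow>
               coefF k' < 0 \<and> coefE k' > 0 \<and> coefC k' < 0 \<and>
               coefD k' > 0 \<and> coefB k' < 0 \<and> coefA k' > 0))"
proof (intro conjI allI impI; (elim conjE)?)
  show "\<exists>k. is_conic k \<and> S \<subseteq> conic_locus k \<and>
      (\<forall>k'. is_conic k' \<and> S \<subseteq> conic_locus k' \<longrightarrow> proportional k k')"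
    using ex_conic_through_five_points[OF assms(4)] proportional_conic_power_curve[OF assms]
    by blast
next
  fix k assume k: "is_conic k" "S \<subseteq> conic_locus k"
  note signs = conic_power_curve_signs[OF assms k(2,1)]
  then have A: "coefA k \<noteq> 0" by auto
  \<comment> \<open>C and A are three places apart in the alternating sequence, hence of opposite
    sign.\<close>
  have "coefA k * coefC k < 0"
    using signs by (auto simp: mult_less_0_iff)
  then have "hyperbolic_type k"
    unfolding hyperbolic_type_def discriminant_def
    using zero_le_power2[of "coefB k"] by linarith
  moreover from this have "nondegenerate k"
    using nondegenerate_conic_power_curve[OF _ assms(2-4) k(2)] A assms(1) by simp
  ultimately show "nondegenerate_hyperbola k"
    using k by (simp add: nondegenerate_hyperbola_def)
  show "\<exists>k'. proportional k k' \<and> coefA k' = 1"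
    using A by (intro exI[of _ "scale_eqn (1 / coefA k) k"])
      (auto simp: proportional_def scale_eqn_def intro!: exI[of _ "1 / coefA k"])
  fix k' assume "proportional k k'" and A': "coefA k' = 1"
  then obtain c where c: "c \<noteq> 0" "k' = scale_eqn c k" by (auto simp: proportional_def)
  \<comment> \<open>The normalization fixes the last sign as positive; alternation then determines
    the other five.\<close>
  have "c * coefA k > 0" using A' c by (simp add: scale_eqn_def)
  then show "coefF k' < 0" "coefE k' > 0" "coefC k' < 0" "coefD k' > 0" "coefB k' < 0"
    "coefA k' > 0"
    using signs c(1) unfolding c(2) scale_eqn_def
    by (auto simp: mult_less_0_iff zero_less_mult_iff)
qed

end
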